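(* Let $\{(X_n,d_n,\mu_n)\}_{n=1}^{\infty}$ be a Lévy family of mm-spaces such that each $\mu_n$ is a uniformly distributed Borel probability measure with $X_n=\operatorname{Supp}\mu_n$, and $\inf_{n\in\mathbb{N}}\operatorname{diam}X_n>0$. Then, for every $\lambda\ge0$, the sequence $\{X_n\}_{n=1}^{\infty}$ does not converge with respect to the distance function $\underline{\square}_\lambda$ on the space of isomorphism classes of mm-spaces; that is, there is no mm-space $X$ with $\underline{\square}_\lambda(X_n,X)\to0$ as $n\to\infty$.
   Context: An mm-space is a triple $(X,d_X,\mu_X)$ where $d_X$ is a complete separable metric on $X$ and $\mu_X$ is a finite Borel measure on $X$. Two mm-spaces are isomorphic if there is a measure-preserving isometry between the supports of their measures. For an mm-space with $\mu_X(X)=m$, a parameter of $X$ is a Borel measurable map $\varphi:[0,m]\to X$ with $\varphi_*(\mathcal{L})=\mu_X$, where $\mathcal{L}$ is Lebesgue measure on $[0,m]$; parameters always exist. For $\lambda\ge0$ and functions $d_1,d_2:[0,m]\times[0,m]\to\mathbb{R}$, $\square_\lambda(d_1,d_2)$ is the infimum of all $\varepsilon>0$ such that there is a measurable set $T_\varepsilon\subseteq[0,m]$ with $\mathcal{L}(T_\varepsilon)\ge m-\lambda\varepsilon$ and $|d_1(s,t)-d_2(s,t)|\le\varepsilon$ for all $s,t\in T_\varepsilon$. Gromov's box distance: if $\mu_X(X)=\mu_Y(Y)=m$, then $\underline{\square}_\lambda(X,Y):=\inf\square_\lambda(\varphi_X^*d_X,\varphi_Y^*d_Y)$, the infimum being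 over all parameters $\varphi_X:[0,m]\to X$, $\varphi_Y:[0,m]\to Y$, where $\varphi_X^*d_X(s,t):=d_X(\varphi_X(s),\varphi_X(t))$. If $m:=\mu_X(X)<m':=\mu_Y(Y)$, then $\underline{\square}_\lambda(X,Y):=\underline{\square}_\lambda\big(X,\tfrac{m}{m'}Y\big)+m'-m$, where $\tfrac{m}{m'}Y:=(Y,d_Y,\tfrac{m}{m'}\mu_Y)$ (and symmetrically when $\mu_X(X)>\mu_Y(Y)$). A Borel measure $\mu$ on a metric space $X$ is uniformly distributed if $0<\mu(B_X(x,r))=\mu(B_X(y,r))<+\infty$ for all $r>0$ and $x,y\in X$, where $B_X(x,r)$ is the closed ball of center $x$ and radius $r$. For a finite Borel measure $\nu$ on $\mathbb{R}$ of total mass $m$ and $\kappa>0$, let $\operatorname{diam}(\nu,m-\kappa):=\inf\{\operatorname{diam}Y\mid Y\subseteq\mathbb{R}\text{ Borel},\ \nu(Y)\ge m-\kappa\}$. For an mm-space $(X,d,\mu)$ with $m=\mu(X)$, its observable diameter is $\operatorname{ObsDiam}(X,\kappa):=\sup\{\operatorname{diam}(f_*(\mu),m-\kappa)\mid f:X\to\mathbb{R}\ \text{1-Lipschitz}\}$. A sequence $\{X_n\}$ of mm-spaces is a Lévy family if $\operatorname{ObsDiam}(X_n,\kappa)\to0$ as $n\to\infty$ for every $\kappa>0$. *)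

theory Defs
  imports "HOL-Probability.Probability"
begin

text \<open>An mm-space is a metric space (with its carrier) together with a measure. Carriers are sets
  inside a type, so that the members of a sequence may be different spaces.\<close>

type_synonym 'a mm_space = "'a metric \<times> 'a measure"

definition is_mm_space :: "'a mm_space \<Rightarrow> bool" where
  "is_mm_space X \<longleftrightarrow>
     mcomplete_of (fst X) \<and> separable_space (mtopology_of (fst X)) \<and>
     sets (snd X) = sets (sigma (mspace (fst X)) {U. openin (mtopology_of (fst X)) U}) \<and>
     finite_measure (snd X)"

definition mm_mass :: "'a mm_space \<Rightarrow> real" where
  "mm_mass X = measure (snd X) (space (snd X))"

definition mm_support :: "'a mm_space \<Rightarrow> 'a set" where
  "mm_support X = {x \<in> mspace (fst X).
     \<forall>U. openin (mtopology_of (fst X)) U \<and> x \<in> U \<longrightarrow> 0 < emeasure (snd X) U}"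

definition mm_scale :: "real \<Rightarrow> 'a mm_space \<Rightarrow> 'a mm_space" where
  "mm_scale c X = (fst X, scale_measure (ennreal c) (snd X))"

text \<open>The diameter takes values in \<open>[0, \<infinity>]\<close>, since the library's \<open>diameter\<close> is real-valued and
  only meaningful on bounded sets. The diameter of the empty set is 0.\<close>

definition ediam :: "('a \<Rightarrow> 'a \<Rightarrow> real) \<Rightarrow> 'a set \<Rightarrow> ennreal" where
  "ediam d S = (SUP x\<in>S. SUP y\<in>S. ennreal (d x y))"

definition mm_diam :: "'a mm_space \<Rightarrow> ennreal" where
  "mm_diam X = ediam (mdist (fst X)) (mspace (fst X))"

definition uniformly_distributed :: "'a mm_space \<Rightarrow> bool" where
  "uniformly_distributed X \<longleftrightarrow>
     (\<forall>r>0. \<forall>x\<in>mspace (fst X). \<forall>y\<in>mspace (fst X).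
        0 < emeasure (snd X) (mcball_of (fst X) x r) \<and>
        emeasure (snd X) (mcball_of (fst X) x r) = emeasure (snd X) (mcball_of (fst X) y r) \<and>
        emeasure (snd X) (mcball_of (fst X) y r) < \<infinity>)"

text \<open>\<open>partial_diam \<nu> \<alpha>\<close> is \<open>diam(\<nu>, \<alpha>)\<close>; if \<open>\<alpha> \<le> 0\<close> the empty set is admissible and it is 0.\<close>

definition partial_diam :: "real measure \<Rightarrow> real \<Rightarrow> ennreal" where
  "partial_diam \<nu> \<alpha> = (INF Y\<in>{Y \<in> sets borel. measure \<nu> Y \<ge> \<alpha>}. ediam dist Y)"

definition obs_diam :: "'a mm_space \<Rightarrow> real \<Rightarrow> ennreal" where
  "obs_diam X \<kappa> =
     (SUP f\<in>{f :: 'a \<Rightarrow> real. \<forall>x\<in>mspace (fst X). \<forall>y\<in>mspace (fst X).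
               \<bar>f x - f y\<bar> \<le> mdist (fst X) x y}.
        partial_diam (distr (snd X) borel f) (mm_mass X - \<kappa>))"

definition levy_family :: "(nat \<Rightarrow> 'a mm_space) \<Rightarrow> bool" where
  "levy_family X \<longleftrightarrow> (\<forall>\<kappa>>0. (\<lambda>n. obs_diam (X n) \<kappa>) \<longlonglongrightarrow> 0)"

definition mm_parameters :: "'a mm_space \<Rightarrow> (real \<Rightarrow> 'a) set" where
  "mm_parameters X =
     {\<phi>. \<phi> \<in> measurable (restrict_space borel {0..mm_mass X}) (snd X) \<and>
         distr (lebesgue_on {0..mm_mass X}) (snd X) \<phi> = snd X}"

text \<open>The argument \<open>m\<close> is the length of the parameter interval. All box distances take values in
  the extended reals: e.g. for \<open>\<lambda> = 0\<close> there may be no admissible \<open>\<epsilon>\<close>.\<close>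

definition box_fun ::
  "real \<Rightarrow> real \<Rightarrow> (real \<Rightarrow> real \<Rightarrow> real) \<Rightarrow> (real \<Rightarrow> real \<Rightarrow> real) \<Rightarrow> ennreal" where
  "box_fun lam m d1 d2 =
     (INF \<epsilon>\<in>{\<epsilon> :: real. \<epsilon> > 0 \<and>
        (\<exists>T \<in> sets lebesgue. T \<subseteq> {0..m} \<and> measure lebesgue T \<ge> m - lam * \<epsilon> \<and>
           (\<forall>s\<in>T. \<forall>t\<in>T. \<bar>d1 s t - d2 s t\<bar> \<le> \<epsilon>))}. ennreal \<epsilon>)"

definition box_dist_eq_mass :: "real \<Rightarrow> 'a mm_space \<Rightarrow> 'b mm_space \<Rightarrow> ennreal" where
  "box_dist_eq_mass lam X Y =
     (INF \<phi>\<in>mm_parameters X. INF \<psi>\<in>mm_parameters Y.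
        box_fun lam (mm_mass X)
          (\<lambda>s t. mdist (fst X) (\<phi> s) (\<phi> t)) (\<lambda>s t. mdist (fst Y) (\<psi> s) (\<psi> t)))"

definition box_dist :: "real \<Rightarrow> 'a mm_space \<Rightarrow> 'b mm_space \<Rightarrow> ennreal" where
  "box_dist lam X Y =
     (let m = mm_mass X; m' = mm_mass Y in
        if m = m' then box_dist_eq_mass lam X Y
        else if m < m' then box_dist_eq_mass lam X (mm_scale (m / m') Y) + ennreal (m' - m)
        else box_dist_eq_mass lam (mm_scale (m' / m) X) Y + ennreal (m - m'))"

end

theory Submission
  imports Defs
begin

text \<open>Suppose that \<open>X\<^sub>n\<close> converges to \<open>Y\<close> and let \<open>\<delta> > 0\<close>. By separability some ball \<open>B\<close> of radius
  \<open>\<delta>\<close> around some \<open>y\<close> in \<open>Y\<close> has positive measure. For large \<open>n\<close> choose parameters \<open>\<phi>\<close> of \<open>X\<^sub>n\<close> and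
  \<open>\<psi>\<close> of \<open>Y\<close> and a set \<open>T\<close> of nearly full measure on which the two pulled back metrics almost agree.
  The distance function of \<open>y\<close> is then transported to a 1-Lipschitz function on \<open>X\<^sub>n\<close>, which is
  nearly constant on a set of nearly full measure because \<open>X\<^sub>n\<close> has small observable diameter. As this
  set meets \<open>B\<close>, the constant is small, so a set of measure more than one half in \<open>X\<^sub>n\<close> has diameter
  \<open>O(\<delta>)\<close>. By uniform distribution every ball of radius \<open>O(\<delta>)\<close> in \<open>X\<^sub>n\<close> has measure more than one
  half, hence any two of them intersect, and \<open>X\<^sub>n\<close> itself has diameter \<open>O(\<delta>)\<close>. So the diameters
  cannot be bounded away from 0.\<close>

section \<open>Borel sets and parameters of mm-spaces\<close>

lemma mm_sets_eq:
  assumes "is_mm_space X"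
  shows "sets (snd X) = sigma_sets (mspace (fst X)) {U. openin (mtopology_of (fst X)) U}"
    and "space (snd X) = mspace (fst X)"
proof -
  have sub: "{U. openin (mtopology_of (fst X)) U} \<subseteq> Pow (mspace (fst X))"
    using openin_subset by fastforce
  have eq: "sets (snd X) = sets (sigma (mspace (fst X)) {U. openin (mtopology_of (fst X)) U})"
    using assms by (simp add: is_mm_space_def)
  then show "sets (snd X) = sigma_sets (mspace (fst X)) {U. openin (mtopology_of (fst X)) U}"
    using sub by simp
  show "space (snd X) = mspace (fst X)"
    using sets_eq_imp_space_eq[OF eq] sub by simp
qed

lemma mm_openin_sets:
  assumes "is_mm_space X" "openin (mtopology_of (fst X)) U"
  shows "U \<in> sets (snd X)"
  using assms by (auto simp: mm_sets_eq)

lemma mm_mcball_sets: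
  assumes "is_mm_space X"
  shows "mcball_of (fst X) x r \<in> sets (snd X)"
proof -
  have "closedin (mtopology_of (fst X)) (mcball_of (fst X) x r)"
    by (simp add: mtopology_of_def mcball_of_def Metric_space.closedin_mcball)
  then have "mspace (fst X) - mcball_of (fst X) x r \<in> sets (snd X)"
    using mm_openin_sets[OF assms] by (simp add: closedin_def)
  then have "space (snd X) - (mspace (fst X) - mcball_of (fst X) x r) \<in> sets (snd X)"
    by (rule sets.compl_sets)
  moreover have "space (snd X) - (mspace (fst X) - mcball_of (fst X) x r) = mcball_of (fst X) x r"
    unfolding mm_sets_eq(2)[OF assms] by (rule double_diff) auto
  ultimately show ?thesis by simp
qed

lemma mm_lipschitz_measurable:
  fixes f :: "'a \<Rightarrow> real"
  assumes "is_mm_space X"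
    and "\<And>x y. x \<in> mspace (fst X) \<Longrightarrow> y \<in> mspace (fst X) \<Longrightarrow> \<bar>f x - f y\<bar> \<le> mdist (fst X) x y"
  shows "f \<in> borel_measurable (snd X)"
proof (rule borel_measurableI)
  fix S :: "real set" assume "open S"
  have "Lipschitz_continuous_map (fst X) euclidean_metric f"
    unfolding Lipschitz_continuous_map_def using assms(2)
    by (auto simp: dist_real_def intro!: exI[of _ 1])
  then have "continuous_map (mtopology_of (fst X)) euclidean f"
    using Lipschitz_continuous_imp_continuous_map by fastforce
  then have "openin (mtopology_of (fst X)) {x \<in> mspace (fst X). f x \<in> S}"
    using \<open>open S\<close> by (auto simp: continuous_map_def)
  moreover have "f -` S \<inter> space (snd X) = {x \<in> mspace (fst X). f x \<in> S}"
    using mm_sets_eq(2)[OF assms(1)] by auto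
  ultimately show "f -` S \<inter> space (snd X) \<in> sets (snd X)"
    using mm_openin_sets[OF assms(1)] by simp
qed

lemma mm_parameters_measure:
  assumes "\<phi> \<in> mm_parameters X" "A \<in> sets (snd X)"
  shows "\<phi> -` A \<inter> {0..mm_mass X} \<in> sets lebesgue"
    and "measure lebesgue (\<phi> -` A \<inter> {0..mm_mass X}) = measure (snd X) A"
proof -
  let ?I = "{0..mm_mass X}"
  have \<phi>: "\<phi> \<in> measurable (restrict_space borel ?I) (snd X)"
    and d: "distr (lebesgue_on ?I) (snd X) \<phi> = snd X"
    using assms(1) by (simp_all add: mm_parameters_def)
  \<comment> \<open>A parameter is Borel measurable, whereas the push-forward uses the completed
    measure. Enlarging the sigma-algebra on the source keeps \<open>\<phi>\<close>
    measurable.\<close>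
  have sub: "sets (restrict_space borel ?I) \<subseteq> sets (lebesgue_on ?I)"
    by (auto simp: sets_restrict_space)
  have \<phi>': "\<phi> \<in> measurable (lebesgue_on ?I) (snd X)"
    using \<phi> sub by (auto simp: measurable_def space_restrict_space)
  then have "\<phi> -` A \<inter> ?I \<in> sets (lebesgue_on ?I)"
    using measurable_sets[OF \<phi>' assms(2)] by (simp add: space_restrict_space)
  then show s: "\<phi> -` A \<inter> ?I \<in> sets lebesgue"
    by (simp add: sets_restrict_space_iff)
  have "measure (snd X) A = measure (lebesgue_on ?I) (\<phi> -` A \<inter> ?I)"
    using measure_distr[OF \<phi>' assms(2)] d by (simp add: space_restrict_space)
  then show "measure lebesgue (\<phi> -` A \<inter> ?I) = measure (snd X) A"
    using s by (simp add: measure_restrict_space)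
qed

lemma mm_parameters_in_mspace:
  assumes "is_mm_space X" "\<phi> \<in> mm_parameters X" "s \<in> {0..mm_mass X}"
  shows "\<phi> s \<in> mspace (fst X)"
proof -
  have "\<phi> \<in> measurable (restrict_space borel {0..mm_mass X}) (snd X)"
    using assms by (auto simp: mm_parameters_def)
  from measurable_space[OF this, of s] show ?thesis
    using assms mm_sets_eq(2)[OF assms(1)] by (simp add: space_restrict_space)
qed

text \<open>Inclusion-exclusion in an interval of length \<open>m\<close>: the missing measures
  \<open>a\<close> and \<open>b\<close> at most add up. This serves both to intersect two nearly
  full sets and to show that a nearly full set meets a set of positive measure.\<close>

lemma measure_Int_ge:
  fixes a b m :: real
  assumes "A \<in> sets lebesgue" "B \<in> sets lebesgue" "A \<subseteq> {0..m}" "B \<subseteq> {0..m}"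
    and "measure lebesgue A \<ge> m - a" "measure lebesgue B \<ge> m - b" "0 \<le> m"
  shows "measure lebesgue (A \<inter> B) \<ge> m - a - b"
proof -
  have I: "{0..m} \<in> lmeasurable" by simp
  have A: "A \<in> lmeasurable" and B: "B \<in> lmeasurable"
    using assms bounded_set_imp_lmeasurable bounded_subset[OF bounded_closed_interval] by blast+
  have "measure lebesgue (A \<union> B) = measure lebesgue A + measure lebesgue B - measure lebesgue (A \<inter> B)"
    using measure_Un3[OF A B] .
  moreover have "measure lebesgue (A \<union> B) \<le> measure lebesgue {0..m}"
    by (rule measure_mono_fmeasurable) (use A B I assms in auto)
  ultimately show ?thesis using assms by simp
qed

section \<open>Witnesses for the box distance and the observable diameter\<close>

text \<open>For unequal masses the difference is a summand of the box distance. A limit of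
  probability spaces therefore has mass 1, and only the equal-mass case remains.\<close>

lemma box_dist_ge_mass_diff: "ennreal \<bar>mm_mass X - mm_mass Y\<bar> \<le> box_dist lam X Y"
  by (auto simp: box_dist_def Let_def abs_if)

lemma box_dist_lessE:
  assumes "mm_mass X = mm_mass Y" "box_dist lam X Y < ennreal \<epsilon>"
  obtains \<phi> \<psi> e T where "\<phi> \<in> mm_parameters X" "\<psi> \<in> mm_parameters Y" "0 < e" "e < \<epsilon>"
    "T \<in> sets lebesgue" "T \<subseteq> {0..mm_mass X}" "measure lebesgue T \<ge> mm_mass X - lam * e"
    "\<And>s t. s \<in> T \<Longrightarrow> t \<in> T \<Longrightarrow> \<bar>mdist (fst X) (\<phi> s) (\<phi> t) - mdist (fst Y) (\<psi> s) (\<psi> t)\<bar> \<le> e"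
proof -
  have "box_dist_eq_mass lam X Y < ennreal \<epsilon>"
    using assms by (simp add: box_dist_def Let_def)
  then obtain \<phi> \<psi> where p: "\<phi> \<in> mm_parameters X" "\<psi> \<in> mm_parameters Y"
    "box_fun lam (mm_mass X) (\<lambda>s t. mdist (fst X) (\<phi> s) (\<phi> t)) (\<lambda>s t. mdist (fst Y) (\<psi> s) (\<psi> t))
       < ennreal \<epsilon>"
    unfolding box_dist_eq_mass_def by (auto simp: INF_less_iff)
  then obtain e T where "0 < e" "ennreal e < ennreal \<epsilon>"
    "T \<in> sets lebesgue" "T \<subseteq> {0..mm_mass X}" "measure lebesgue T \<ge> mm_mass X - lam * e"
    "\<forall>s\<in>T. \<forall>t\<in>T. \<bar>mdist (fst X) (\<phi> s) (\<phi> t) - mdist (fst Y) (\<psi> s) (\<psi> t)\<bar> \<le> e"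
    unfolding box_fun_def by (auto simp: INF_less_iff)
  with p that[of \<phi> \<psi> e T] show thesis by (auto simp: ennreal_less_iff)
qed

lemma obs_diam_lessE:
  fixes f :: "'a \<Rightarrow> real"
  assumes "is_mm_space X" "obs_diam X \<kappa> < ennreal \<delta>"
    and lip: "\<And>x y. x \<in> mspace (fst X) \<Longrightarrow> y \<in> mspace (fst X) \<Longrightarrow> \<bar>f x - f y\<bar> \<le> mdist (fst X) x y"
  obtains Z where "Z \<in> sets borel" "f -` Z \<inter> space (snd X) \<in> sets (snd X)"
    "measure (snd X) (f -` Z \<inter> space (snd X)) \<ge> mm_mass X - \<kappa>"
    "\<And>a b. a \<in> Z \<Longrightarrow> b \<in> Z \<Longrightarrow> dist a b < \<delta>"
proof -
  have f: "f \<in> borel_measurable (snd X)"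
    by (rule mm_lipschitz_measurable[OF assms(1) lip])
  have "partial_diam (distr (snd X) borel f) (mm_mass X - \<kappa>) \<le> obs_diam X \<kappa>"
    unfolding obs_diam_def by (rule SUP_upper) (use lip in auto)
  then have "partial_diam (distr (snd X) borel f) (mm_mass X - \<kappa>) < ennreal \<delta>"
    using assms(2) by (rule le_less_trans)
  then obtain Z where Z: "Z \<in> sets borel" "measure (distr (snd X) borel f) Z \<ge> mm_mass X - \<kappa>"
    "ediam dist Z < ennreal \<delta>"
    unfolding partial_diam_def by (auto simp: INF_less_iff)
  have "dist a b < \<delta>" if "a \<in> Z" "b \<in> Z" for a b
  proof -
    have "ennreal (dist a b) \<le> ediam dist Z"
      unfolding ediam_def using that by (intro SUP_upper2[of a] SUP_upper2[of b]) auto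
    then have "ennreal (dist a b) < ennreal \<delta>" using Z(3) by (rule le_less_trans)
    then show ?thesis by (simp add: ennreal_less_iff)
  qed
  then show thesis
    using that[of Z] Z f measurable_sets[OF f Z(1)] by (simp add: measure_distr)
qed

section \<open>Balls and Lipschitz extension\<close>

text \<open>Balls around a countable dense set cover the space, so they cannot all be null
  sets.\<close>

lemma mm_positive_ball:
  assumes "is_mm_space X" "0 < mm_mass X" "0 < r"
  obtains x where "x \<in> mspace (fst X)" "0 < measure (snd X) (mcball_of (fst X) x r)"
proof -
  interpret finite_measure "snd X" using assms by (simp add: is_mm_space_def)
  obtain C where C: "countable C" "C \<subseteq> mspace (fst X)"
    "mtopology_of (fst X) closure_of C = mspace (fst X)"
    using assms unfolding is_mm_space_def separable_space_def by auto
  have cover: "space (snd X) = (\<Union>c\<in>C. mcball_of (fst X) c r)"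
  proof
    show "space (snd X) \<subseteq> (\<Union>c\<in>C. mcball_of (fst X) c r)"
    proof
      fix x assume "x \<in> space (snd X)"
      then have x: "x \<in> mspace (fst X)" using mm_sets_eq(2)[OF assms(1)] by simp
      have "openin (mtopology_of (fst X)) (mball_of (fst X) x r)"
        by (simp add: mtopology_of_def mball_of_def Metric_space.openin_mball)
      moreover have "x \<in> mball_of (fst X) x r" by (metis in_mball_of mdist_zero x assms(3))
      ultimately obtain c where "c \<in> C" "c \<in> mball_of (fst X) x r"
        using x C(3) in_closure_of[of x "mtopology_of (fst X)" C] by blast
      then show "x \<in> (\<Union>c\<in>C. mcball_of (fst X) c r)"
        by (auto simp: mdist_commute intro!: bexI[of _ c])
    qed
    show "(\<Union>c\<in>C. mcball_of (fst X) c r) \<subseteq> space (snd X)"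
      using sets.sets_into_space[OF mm_mcball_sets[OF assms(1)]] by (rule UN_least)
  qed
  have "\<exists>c\<in>C. measure (snd X) (mcball_of (fst X) c r) \<noteq> 0"
  proof (rule ccontr)
    assume "\<not> ?thesis"
    then have "\<forall>c\<in>C. mcball_of (fst X) c r \<in> null_sets (snd X)"
      using mm_mcball_sets[OF assms(1)] by (auto simp: null_sets_def emeasure_eq_measure)
    then have "space (snd X) \<in> null_sets (snd X)"
      unfolding cover using C(1) by (intro null_sets_UN') auto
    then show False using assms(2) by (auto simp: mm_mass_def null_sets_def measure_def)
  qed
  then obtain c where "c \<in> C" "0 < measure (snd X) (mcball_of (fst X) c r)"
    by (auto simp: zero_less_measure_iff)
  then show thesis using that C(2) by blast
qed

lemma mm_diam_le_if_large_ball: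
  assumes X: "is_mm_space X" and "uniformly_distributed X" and x: "x \<in> mspace (fst X)" and "0 < r"
    and large: "measure (snd X) (mcball_of (fst X) x r) > mm_mass X / 2"
  shows "mm_diam X \<le> ennreal (2 * r)"
proof -
  interpret finite_measure "snd X" using X by (simp add: is_mm_space_def)
  have large': "measure (snd X) (mcball_of (fst X) y r) > mm_mass X / 2" if "y \<in> mspace (fst X)" for y
    using assms(2) x \<open>0 < r\<close> that large unfolding uniformly_distributed_def measure_def by metis
  have "mdist (fst X) y z \<le> 2 * r" if y: "y \<in> mspace (fst X)" and z: "z \<in> mspace (fst X)" for y z
  proof -
    let ?A = "mcball_of (fst X) y r" and ?B = "mcball_of (fst X) z r"
    have "?A \<inter> ?B \<noteq> {}"
    proof
      assume "?A \<inter> ?B = {}"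
      then have "measure (snd X) (?A \<union> ?B) = measure (snd X) ?A + measure (snd X) ?B"
        by (intro finite_measure_Union mm_mcball_sets X)
      moreover have "measure (snd X) (?A \<union> ?B) \<le> mm_mass X"
        unfolding mm_mass_def by (rule bounded_measure)
      ultimately show False using large'[OF y] large'[OF z] by simp
    qed
    then obtain w where "w \<in> ?A" "w \<in> ?B" by blast
    then show ?thesis
      using mdist_triangle[of y "fst X" w z] mdist_commute[of "fst X" w z] by auto
  qed
  then show ?thesis
    unfolding mm_diam_def ediam_def by (intro SUP_least ennreal_leI) auto
qed

text \<open>McShane's extension of \<open>\<phi> t \<mapsto> f t\<close>, which is 1-Lipschitz only up to the error \<open>e\<close>.\<close>

lemma almost_lipschitz_approx:
  fixes f :: "'i \<Rightarrow> real"
  assumes "T \<noteq> {}" and \<phi>: "\<And>t. t \<in> T \<Longrightarrow> \<phi> t \<in> mspace M"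
    and nonneg: "\<And>t. t \<in> T \<Longrightarrow> 0 \<le> f t"
    and almost: "\<And>s t. s \<in> T \<Longrightarrow> t \<in> T \<Longrightarrow> f s - f t \<le> mdist M (\<phi> s) (\<phi> t) + e"
  obtains g where "\<And>x y. x \<in> mspace M \<Longrightarrow> y \<in> mspace M \<Longrightarrow> \<bar>g x - g y\<bar> \<le> mdist M x y"
    and "\<And>t. t \<in> T \<Longrightarrow> g (\<phi> t) \<le> f t" and "\<And>t. t \<in> T \<Longrightarrow> f t \<le> g (\<phi> t) + e"
proof -
  \<comment> \<open>The infimum runs over \<open>T\<close> rather than over its image, so
    \<open>\<phi>\<close> may fail to be injective. Nonnegativity of \<open>f\<close> bounds the
    real infimum from below.\<close>
  define g where "g x = (INF t\<in>T. f t + mdist M x (\<phi> t))" for x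
  have bdd: "bdd_below ((\<lambda>t. f t + mdist M x (\<phi> t)) ` T)" for x
    using nonneg by (intro bdd_belowI[of _ 0]) auto
  have one: "g x - g y \<le> mdist M x y" if "x \<in> mspace M" "y \<in> mspace M" for x y
  proof -
    have "g x - mdist M x y \<le> f t + mdist M y (\<phi> t)" if t: "t \<in> T" for t
    proof -
      have "g x \<le> f t + mdist M x (\<phi> t)" unfolding g_def by (rule cINF_lower[OF bdd t])
      also have "\<dots> \<le> f t + (mdist M x y + mdist M y (\<phi> t))"
        using mdist_triangle \<open>x \<in> mspace M\<close> \<open>y \<in> mspace M\<close> \<phi>[OF t] by simp
      finally show ?thesis by simp
    qed
    then have "g x - mdist M x y \<le> g y"
      unfolding g_def[of y] using \<open>T \<noteq> {}\<close> by (intro cINF_greatest)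
    then show ?thesis by simp
  qed
  show thesis
  proof (rule that)
    fix x y assume "x \<in> mspace M" "y \<in> mspace M"
    then show "\<bar>g x - g y\<bar> \<le> mdist M x y"
      using one[of x y] one[of y x] mdist_commute[of M x y] by (simp add: abs_le_iff)
  next
    fix t assume t: "t \<in> T"
    have "g (\<phi> t) \<le> f t + mdist M (\<phi> t) (\<phi> t)" unfolding g_def by (rule cINF_lower[OF bdd t])
    then show "g (\<phi> t) \<le> f t" by (metis mdist_zero \<phi>[OF t] add_0_right)
    have "f t - e \<le> g (\<phi> t)"
      unfolding g_def using \<open>T \<noteq> {}\<close>
    proof (rule cINF_greatest)
      fix s assume "s \<in> T"
      then show "f t - e \<le> f s + mdist M (\<phi> t) (\<phi> s)" using almost[OF t] by fastforce
    qed
    then show "f t \<le> g (\<phi> t) + e" by simp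
  qed
qed

section \<open>The diameter estimate\<close>

text \<open>The thresholds keep both losses of measure, from \<open>T\<close> and from the
  observable diameter, below or at \<open>p / 8\<close>; together they are less than the measure
  \<open>p\<close> of the ball in \<open>Y\<close>.\<close>

lemma mm_diam_le_if_box_close:
  fixes X :: "'a mm_space" and Y :: "'b mm_space"
  assumes X: "is_mm_space X" and Y: "is_mm_space Y"
    and uX: "uniformly_distributed X" and mX: "mm_mass X = 1" and mY: "mm_mass Y = 1"
    and y: "y \<in> mspace (fst Y)" and p: "p = measure (snd Y) (mcball_of (fst Y) y \<delta>)" "0 < p"
    and \<delta>: "0 < \<delta>" and lam: "0 \<le> lam"
    and obs: "obs_diam X (p / 8) < ennreal \<delta>"
    and box: "box_dist lam X Y < ennreal (min \<delta> (p / (8 * (lam + 1))))"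
  shows "mm_diam X \<le> ennreal (14 * \<delta>)"
proof -
  interpret Y: finite_measure "snd Y" using Y by (simp add: is_mm_space_def)
  let ?dX = "mdist (fst X)" and ?dY = "mdist (fst Y)" and ?L = "measure lebesgue"
  have p1: "p \<le> 1" using Y.bounded_measure p(1) mY by (simp add: mm_mass_def)
  have mXY: "mm_mass X = mm_mass Y" using mX mY by simp
  obtain \<phi> \<psi> e T where \<phi>: "\<phi> \<in> mm_parameters X" and \<psi>: "\<psi> \<in> mm_parameters Y"
    and e: "0 < e" "e < min \<delta> (p / (8 * (lam + 1)))"
    and T: "T \<in> sets lebesgue" "T \<subseteq> {0..1}" "?L T \<ge> 1 - lam * e"
    and close: "\<And>s t. s \<in> T \<Longrightarrow> t \<in> T \<Longrightarrow> \<bar>?dX (\<phi> s) (\<phi> t) - ?dY (\<psi> s) (\<psi> t)\<bar> \<le> e"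
    using box_dist_lessE[OF mXY box] unfolding mX by metis
  have \<phi>X: "\<phi> t \<in> mspace (fst X)" and \<psi>Y: "\<psi> t \<in> mspace (fst Y)" if "t \<in> T" for t
    using that T(2) mm_parameters_in_mspace[OF X \<phi>] mm_parameters_in_mspace[OF Y \<psi>] mX mY by auto
  \<comment> \<open>The denominator uses \<open>lam + 1\<close> so that \<open>lam = 0\<close> needs
    no separate treatment.\<close>
  have "lam * e \<le> (lam + 1) * e" using e by simp
  also have "\<dots> < p / 8" using e lam by (simp add: field_simps)
  finally have le: "lam * e < p / 8" .
  have "T \<noteq> {}" using T(3) le p1 by auto
  moreover have "?dY y (\<psi> s) - ?dY y (\<psi> t) \<le> ?dX (\<phi> s) (\<phi> t) + e" if "s \<in> T" "t \<in> T" for s t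
    using mdist_triangle[OF y \<psi>Y \<psi>Y, of t s] close[of t s] that mdist_commute[of _ "\<phi> s" "\<phi> t"]
    by fastforce
  ultimately obtain g
    where lip: "\<And>u v. u \<in> mspace (fst X) \<Longrightarrow> v \<in> mspace (fst X) \<Longrightarrow> \<bar>g u - g v\<bar> \<le> ?dX u v"
      and g1: "\<And>t. t \<in> T \<Longrightarrow> g (\<phi> t) \<le> ?dY y (\<psi> t)"
      and g2: "\<And>t. t \<in> T \<Longrightarrow> ?dY y (\<psi> t) \<le> g (\<phi> t) + e"
    using almost_lipschitz_approx[of T \<phi> "fst X" "\<lambda>t. ?dY y (\<psi> t)" e, OF _ \<phi>X mdist_nonneg]
    by metis
  obtain Z where Z: "g -` Z \<inter> space (snd X) \<in> sets (snd X)"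
    "measure (snd X) (g -` Z \<inter> space (snd X)) \<ge> 1 - p / 8"
    "\<And>a b. a \<in> Z \<Longrightarrow> b \<in> Z \<Longrightarrow> dist a b < \<delta>"
    using obs_diam_lessE[OF X obs lip] mX by metis
  define S where "S = T \<inter> (\<phi> -` (g -` Z \<inter> space (snd X)) \<inter> {0..1})"
  define R where "R = \<psi> -` mcball_of (fst Y) y \<delta> \<inter> {0..1}"
  have S: "S \<in> sets lebesgue" "S \<subseteq> {0..1}"
    using T mm_parameters_measure(1)[OF \<phi> Z(1)] mX by (auto simp: S_def)
  have "?L S \<ge> 1 - p / 8 - p / 8"
    unfolding S_def
    by (rule measure_Int_ge)
      (use T le mm_parameters_measure[OF \<phi> Z(1)] Z(2) mX in auto)
  then have LS: "?L S \<ge> 1 - p / 4" by simp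
  have R: "R \<in> sets lebesgue" "?L R = p"
    using mm_parameters_measure[OF \<psi> mm_mcball_sets[OF Y]] mY p(1) by (auto simp: R_def)
  \<comment> \<open>\<open>R\<close> misses measure \<open>1 - p\<close> of the interval, so the
    intersection has measure at least \<open>3 * p / 4\<close>.\<close>
  have "?L (S \<inter> R) \<ge> 1 - p / 4 - (1 - p)"
    by (rule measure_Int_ge) (use S LS R in \<open>auto simp: R_def\<close>)
  then have "S \<inter> R \<noteq> {}" using p(2) by auto
  then obtain s0 where s0: "s0 \<in> S" "?dY y (\<psi> s0) \<le> \<delta>" by (auto simp: R_def)
  have ST: "s \<in> T" if "s \<in> S" for s using that by (simp add: S_def)
  \<comment> \<open>Three errors of at most \<open>\<delta>\<close> add up: \<open>e\<close> from
    comparing \<open>g\<close> with the distance to \<open>y\<close>, the oscillation of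
    \<open>g\<close> on \<open>S\<close>, and the distance from \<open>y\<close> to
    \<open>\<psi> s0\<close>.\<close>
  have near: "?dY y (\<psi> s) \<le> 3 * \<delta>" if s: "s \<in> S" for s
  proof -
    have "\<bar>g (\<phi> s) - g (\<phi> s0)\<bar> < \<delta>"
      using Z(3)[of "g (\<phi> s)" "g (\<phi> s0)"] s s0 by (auto simp: S_def dist_real_def)
    moreover have "e < \<delta>" using e by simp
    ultimately show ?thesis using g2[OF ST[OF s]] g1[OF ST[OF s0(1)]] s0(2) by linarith
  qed
  \<comment> \<open>Going through \<open>y\<close> costs \<open>3 * \<delta>\<close> twice, and
    returning from \<open>Y\<close> to \<open>X\<close> costs \<open>e < \<delta>\<close>.\<close>
  have small: "?dX (\<phi> s) (\<phi> s0) \<le> 7 * \<delta>" if s: "s \<in> S" for s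
    using mdist_triangle[OF \<psi>Y[OF ST[OF s]] y \<psi>Y[OF ST[OF s0(1)]]] mdist_commute[of "fst Y" "\<psi> s" y]
      near[OF s] near[OF s0(1)] close[OF ST[OF s] ST[OF s0(1)]] e by auto
  let ?B = "mcball_of (fst X) (\<phi> s0) (7 * \<delta>)"
  have "S \<subseteq> \<phi> -` ?B \<inter> {0..1}"
    using small S(2) \<phi>X ST s0(1) mdist_commute[of "fst X" "\<phi> s0"] by auto
  moreover have B: "\<phi> -` ?B \<inter> {0..1} \<in> sets lebesgue" "?L (\<phi> -` ?B \<inter> {0..1}) = measure (snd X) ?B"
    using mm_parameters_measure[OF \<phi> mm_mcball_sets[OF X]] mX by auto
  moreover have "\<phi> -` ?B \<inter> {0..1} \<in> lmeasurable"
    by (rule bounded_set_imp_lmeasurable[OF bounded_subset[OF bounded_closed_interval]])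
      (use B in auto)
  ultimately have "?L S \<le> measure (snd X) ?B"
    using measure_mono_fmeasurable[of S "\<phi> -` ?B \<inter> {0..1}" lebesgue] S by simp
  \<comment> \<open>Since \<open>p \<le> 1\<close>, the bound \<open>1 - p / 4\<close> is at least
    \<open>3 / 4\<close>.\<close>
  then have "measure (snd X) ?B > mm_mass X / 2" using LS p1 p(2) mX by simp
  then show ?thesis
    using mm_diam_le_if_large_ball[OF X uX \<phi>X[OF ST[OF s0(1)]], of "7 * \<delta>"] \<delta> by simp
qed

theorem proposition3p1:
  fixes X :: "nat \<Rightarrow> 'a mm_space" and lam :: real
  assumes "\<And>n. is_mm_space (X n)"
    and "levy_family X"
    and "\<And>n. prob_space (snd (X n))"
    and "\<And>n. uniformly_distributed (X n)"
    and "\<And>n. mspace (fst (X n)) = mm_support (X n)"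
    and "(INF n. mm_diam (X n)) > 0"
    and "lam \<ge> 0"
  shows "\<not> (\<exists>Y :: 'b mm_space. is_mm_space Y \<and> (\<lambda>n. box_dist lam (X n) Y) \<longlonglongrightarrow> 0)"
proof
  assume "\<exists>Y :: 'b mm_space. is_mm_space Y \<and> (\<lambda>n. box_dist lam (X n) Y) \<longlonglongrightarrow> 0"
  then obtain Y :: "'b mm_space" where Y: "is_mm_space Y"
    and lim: "(\<lambda>n. box_dist lam (X n) Y) \<longlonglongrightarrow> 0" by blast
  have mX: "mm_mass (X n) = 1" for n
    using assms(3) by (simp add: mm_mass_def prob_space.prob_space)
  have "ennreal \<bar>1 - mm_mass Y\<bar> \<le> 0"
    using lim by (rule LIMSEQ_le_const) (metis box_dist_ge_mass_diff mX)
  then have mY: "mm_mass Y = 1" by (simp add: ennreal_eq_0_iff)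
  \<comment> \<open>The infimum of the diameters may be infinite, so a positive real number strictly
    below it is chosen.\<close>
  obtain c where c: "0 < c" "ennreal c < (INF n. mm_diam (X n))"
  proof -
    obtain d where d: "0 < d" "d < (INF n. mm_diam (X n))" using dense[OF assms(6)] by blast
    then obtain c where "d = ennreal c" "0 \<le> c" by (cases d) auto
    with d that[of c] show thesis by (auto simp: ennreal_less_zero_iff)
  qed
  \<comment> \<open>With this choice the bound \<open>14 * \<delta>\<close> on the diameter equals
    \<open>c\<close>.\<close>
  define \<delta> where "\<delta> = c / 14"
  have \<delta>: "0 < \<delta>" using c by (simp add: \<delta>_def)
  obtain y where y: "y \<in> mspace (fst Y)" "0 < measure (snd Y) (mcball_of (fst Y) y \<delta>)"
    using mm_positive_ball[OF Y _ \<delta>] mY by auto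
  \<comment> \<open>The ball lies in the limit \<open>Y\<close>, so \<open>p\<close> does not depend
    on \<open>n\<close> and \<open>p / 8\<close> is a legitimate fixed parameter in the Levy
    condition.\<close>
  define p where "p = measure (snd Y) (mcball_of (fst Y) y \<delta>)"
  have p: "0 < p" using y by (simp add: p_def)
  have "(\<lambda>n. obs_diam (X n) (p / 8)) \<longlonglongrightarrow> 0"
    using assms(2) p by (simp add: levy_family_def)
  then have "\<forall>\<^sub>F n in sequentially. obs_diam (X n) (p / 8) < ennreal \<delta>"
    by (rule order_tendstoD) (use \<delta> in simp)
  moreover have "\<forall>\<^sub>F n in sequentially. box_dist lam (X n) Y < ennreal (min \<delta> (p / (8 * (lam + 1))))"
    using lim by (rule order_tendstoD) (use \<delta> p assms(7) in simp)
  ultimately obtain n where n: "obs_diam (X n) (p / 8) < ennreal \<delta>"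
    "box_dist lam (X n) Y < ennreal (min \<delta> (p / (8 * (lam + 1))))"
    using eventually_conj eventually_happens'[OF sequentially_bot] by blast
  have "mm_diam (X n) \<le> ennreal (14 * \<delta>)"
    by (rule mm_diam_le_if_box_close[OF assms(1) Y assms(4) mX mY y(1) p_def p \<delta> assms(7) n])
  moreover have "(INF n. mm_diam (X n)) \<le> mm_diam (X n)" by (rule INF_lower) simp
  ultimately show False using c by (simp add: \<delta>_def)
qed

end
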